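(* Let $n\ge 2$ be an integer, let $w\in\mathbb{Z}$ and let $\pi\in S_n$. There is a braid $\beta\in B_n$ with writhe $|\beta|=w$ and permutation $\pi_\beta=\pi$ if and only if $\pi$ and $w$ have the same parity (that is, $\pi$ is an even permutation if and only if $w$ is an even integer).
   Context: $B_n$ is the braid group on $n$ strands, with presentation by the Artin generators $\sigma_1,\dots,\sigma_{n-1}$ subject to $\sigma_i\sigma_{i+1}\sigma_i=\sigma_{i+1}\sigma_i\sigma_{i+1}$ for all $1\le i\le n-2$ and $\sigma_i\sigma_j=\sigma_j\sigma_i$ whenever $|i-j|>1$. The writhe $\beta\mapsto|\beta|$ is the group homomorphism $B_n\to\mathbb{Z}$ with $\sigma_i\mapsto 1$ for all $i$. The permutation $\beta\mapsto\pi_\beta$ is the group homomorphism $B_n\to S_n$ with $\sigma_i\mapsto(i,i+1)$ (a transposition) for all $i$. *)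

theory Defs
  imports "HOL-Algebra.Elementary_Groups" "HOL-Algebra.Sym_Groups"
begin

text \<open>
  The pair \<open>(i, True)\<close> is the letter \<open>\<sigma>\<^sub>i\<close> and \<open>(i, False)\<close> is its formal inverse.
\<close>

type_synonym braid_word = "(nat \<times> bool) list"

definition braid_words :: "nat \<Rightarrow> braid_word set"
  where "braid_words n = lists ({1..<n} \<times> UNIV)"

text \<open>
  Equality in \<open>B\<^sub>n\<close>: the smallest congruence on words in the letters \<open>\<sigma>\<^sub>1\<^sup>\<plusminus>, \<dots>, \<sigma>\<^sub>n\<^sub>-\<^sub>1\<^sup>\<plusminus>\<close> that
  contains free cancellation and the defining relations.
\<close>

inductive braid_eq :: "nat \<Rightarrow> braid_word \<Rightarrow> braid_word \<Rightarrow> bool" for n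
  where
    refl: "u \<in> braid_words n \<Longrightarrow> braid_eq n u u"
  | sym: "braid_eq n u v \<Longrightarrow> braid_eq n v u"
  | trans: "braid_eq n u v \<Longrightarrow> braid_eq n v w \<Longrightarrow> braid_eq n u w"
  | append: "braid_eq n u u' \<Longrightarrow> braid_eq n v v' \<Longrightarrow> braid_eq n (u @ v) (u' @ v')"
  | cancel: "i \<in> {1..<n} \<Longrightarrow> braid_eq n [(i, b), (i, \<not> b)] []"
  | braid: "1 \<le> i \<Longrightarrow> i + 2 \<le> n \<Longrightarrow>
      braid_eq n [(i, True), (i + 1, True), (i, True)] [(i + 1, True), (i, True), (i + 1, True)]"
  | far: "i \<in> {1..<n} \<Longrightarrow> j \<in> {1..<n} \<Longrightarrow> 1 < \<bar>int i - int j\<bar> \<Longrightarrow>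
      braid_eq n [(i, True), (j, True)] [(j, True), (i, True)]"

definition braid_rel :: "nat \<Rightarrow> (braid_word \<times> braid_word) set"
  where "braid_rel n = {(u, v). braid_eq n u v}"

definition braid_group :: "nat \<Rightarrow> braid_word set monoid"
  where "braid_group n =
    \<lparr> carrier = braid_words n // braid_rel n,
      monoid.mult = (\<lambda>\<beta> \<gamma>. \<Union>u\<in>\<beta>. \<Union>v\<in>\<gamma>. braid_rel n `` {u @ v}),
      one = braid_rel n `` {[]} \<rparr>"

definition artin_gen :: "nat \<Rightarrow> nat \<Rightarrow> braid_word set"
  where "artin_gen n i = braid_rel n `` {[(i, True)]}"

definition word_writhe :: "braid_word \<Rightarrow> int"
  where "word_writhe u = (\<Sum>(i, b)\<leftarrow>u. if b then 1 else - 1)"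

definition word_perm :: "braid_word \<Rightarrow> nat \<Rightarrow> nat"
  where "word_perm u = foldr (\<lambda>(i, b) p. transpose i (i + 1) \<circ> p) u id"

text \<open>
  Both maps are constant on the classes of \<^const>\<open>braid_rel\<close>, so \<^const>\<open>the_elem\<close> picks that
  constant value.  They are the homomorphisms determined by \<open>\<sigma>\<^sub>i \<mapsto> 1\<close> and \<open>\<sigma>\<^sub>i \<mapsto> (i, i + 1)\<close>: see
  \<open>writhe_hom\<close>, \<open>braid_perm_hom\<close> and \<open>braid_hom_unique\<close> below.
\<close>

definition writhe :: "braid_word set \<Rightarrow> int"
  where "writhe \<beta> = the_elem (word_writhe ` \<beta>)"

definition braid_perm :: "braid_word set \<Rightarrow> nat \<Rightarrow> nat"
  where "braid_perm \<beta> = the_elem (word_perm ` \<beta>)"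


lemma braid_words_Nil [simp]: "[] \<in> braid_words n"
  by (simp add: braid_words_def)

lemma braid_words_Cons [simp]: "(i, b) # u \<in> braid_words n \<longleftrightarrow> i \<in> {1..<n} \<and> u \<in> braid_words n"
  by (auto simp: braid_words_def)

lemma braid_words_append [simp]: "u @ v \<in> braid_words n \<longleftrightarrow> u \<in> braid_words n \<and> v \<in> braid_words n"
  by (auto simp: braid_words_def)

lemma braid_eq_words: "braid_eq n u v \<Longrightarrow> u \<in> braid_words n \<and> v \<in> braid_words n"
  by (induction rule: braid_eq.induct) auto

lemma equiv_braid_rel: "equiv (braid_words n) (braid_rel n)"
  by (rule equivI)
    (auto simp: braid_rel_def refl_on_def sym_def trans_def
      dest: braid_eq_words intro: braid_eq.refl braid_eq.sym braid_eq.trans)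

lemma word_writhe_append: "word_writhe (u @ v) = word_writhe u + word_writhe v"
  by (simp add: word_writhe_def)

lemma word_perm_Nil [simp]: "word_perm [] = id"
  by (simp add: word_perm_def)

lemma word_perm_Cons [simp]: "word_perm ((i, b) # u) = transpose i (i + 1) \<circ> word_perm u"
  by (simp add: word_perm_def)

lemma word_perm_append: "word_perm (u @ v) = word_perm u \<circ> word_perm v"
  by (induction u) (auto simp: comp_assoc)

lemma word_perm_permutes: "u \<in> braid_words n \<Longrightarrow> word_perm u permutes {1..n}"
proof (induction u)
  case (Cons a u)
  obtain i b where a: "a = (i, b)" by (cases a)
  have "transpose i (i + 1) permutes {1..n}"
    using Cons.prems a by (intro permutes_swap_id) auto
  then show ?case
    using Cons a permutes_compose by (simp del: o_apply)
qed (simp add: permutes_id)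

lemma braid_eq_word_writhe: "braid_eq n u v \<Longrightarrow> word_writhe u = word_writhe v"
  by (induction rule: braid_eq.induct) (auto simp: word_writhe_append, auto simp: word_writhe_def)

lemma braid_eq_word_perm: "braid_eq n u v \<Longrightarrow> word_perm u = word_perm v"
proof (induction rule: braid_eq.induct)
  case (braid i)
  then show ?case by (auto simp: fun_eq_iff transpose_def)
next
  case (far i j)
  then show ?case by (auto simp: fun_eq_iff transpose_def)
qed (auto simp: word_perm_append fun_eq_iff)

lemma the_elem_braid_class:
  assumes "u \<in> braid_words n" "\<And>v. braid_eq n u v \<Longrightarrow> f u = f v"
  shows "the_elem (f ` (braid_rel n `` {u})) = f u"
proof -
  have "f ` (braid_rel n `` {u}) = {f u}"
    using assms by (auto simp: braid_rel_def intro!: image_eqI[where x = u] braid_eq.refl)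
  then show ?thesis by simp
qed

lemma writhe_class: "u \<in> braid_words n \<Longrightarrow> writhe (braid_rel n `` {u}) = word_writhe u"
  unfolding writhe_def by (rule the_elem_braid_class) (auto dest: braid_eq_word_writhe)

lemma braid_perm_class: "u \<in> braid_words n \<Longrightarrow> braid_perm (braid_rel n `` {u}) = word_perm u"
  unfolding braid_perm_def by (rule the_elem_braid_class) (auto dest: braid_eq_word_perm)

lemma class_in_carrier: "u \<in> braid_words n \<Longrightarrow> braid_rel n `` {u} \<in> carrier (braid_group n)"
  by (simp add: braid_group_def quotientI)

lemma carrier_braid_groupE:
  assumes "\<beta> \<in> carrier (braid_group n)"
  obtains u where "u \<in> braid_words n" "\<beta> = braid_rel n `` {u}"
  using assms by (auto simp: braid_group_def elim: quotientE)

lemma class_mult: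
  assumes "u \<in> braid_words n" "v \<in> braid_words n"
  shows "braid_rel n `` {u} \<otimes>\<^bsub>braid_group n\<^esub> braid_rel n `` {v} = braid_rel n `` {u @ v}"
proof -
  have "(\<lambda>u v. braid_rel n `` {u @ v}) respects2 braid_rel n"
    by (rule congruent2I', rule equiv_class_eq[OF equiv_braid_rel])
      (auto simp: braid_rel_def intro: braid_eq.append)
  from UN_equiv_class2[OF equiv_braid_rel equiv_braid_rel this assms]
  show ?thesis by (simp add: braid_group_def)
qed

lemma class_inverse:
  "u \<in> braid_words n \<Longrightarrow> \<exists>v \<in> braid_words n. braid_eq n (v @ u) []"
proof (induction u)
  case Nil
  then show ?case by (auto intro!: bexI[of _ "[]"] braid_eq.refl)
next
  case (Cons a u)
  obtain i b where a: "a = (i, b)" by (cases a)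
  from Cons a obtain v where v: "v \<in> braid_words n" "braid_eq n (v @ u) []" by auto
  have i: "i \<in> {1..<n}" and u: "u \<in> braid_words n" using Cons.prems a by auto
  have "braid_eq n ((v @ [(i, \<not> b), (i, b)]) @ u) ((v @ []) @ u)"
    using braid_eq.cancel[OF i, of "\<not> b"] u v(1)
    by (intro braid_eq.append braid_eq.refl) auto
  then have "braid_eq n ((v @ [(i, \<not> b)]) @ (a # u)) []"
    using v(2) a by (auto intro: braid_eq.trans)
  then show ?case using v i by (intro bexI[of _ "v @ [(i, \<not> b)]"]) auto
qed

lemma group_braid_group: "group (braid_group n)"
proof (rule groupI)
  have one: "\<one>\<^bsub>braid_group n\<^esub> = braid_rel n `` {[]}"
    by (simp add: braid_group_def)
  show "\<one>\<^bsub>braid_group n\<^esub> \<in> carrier (braid_group n)"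
    by (simp add: one class_in_carrier)
  show "x \<otimes>\<^bsub>braid_group n\<^esub> y \<in> carrier (braid_group n)"
    if "x \<in> carrier (braid_group n)" "y \<in> carrier (braid_group n)" for x y
    using that by (auto elim!: carrier_braid_groupE simp: class_mult class_in_carrier)
  show "x \<otimes>\<^bsub>braid_group n\<^esub> y \<otimes>\<^bsub>braid_group n\<^esub> z = x \<otimes>\<^bsub>braid_group n\<^esub> (y \<otimes>\<^bsub>braid_group n\<^esub> z)"
    if "x \<in> carrier (braid_group n)" "y \<in> carrier (braid_group n)" "z \<in> carrier (braid_group n)"
    for x y z
    using that by (auto elim!: carrier_braid_groupE simp: class_mult)
  show "\<one>\<^bsub>braid_group n\<^esub> \<otimes>\<^bsub>braid_group n\<^esub> x = x" if "x \<in> carrier (braid_group n)" for x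
    using that by (auto elim!: carrier_braid_groupE simp: class_mult one)
  show "\<exists>y \<in> carrier (braid_group n). y \<otimes>\<^bsub>braid_group n\<^esub> x = \<one>\<^bsub>braid_group n\<^esub>"
    if x: "x \<in> carrier (braid_group n)" for x
  proof -
    obtain u where u: "u \<in> braid_words n" "x = braid_rel n `` {u}"
      using x by (rule carrier_braid_groupE)
    obtain v where v: "v \<in> braid_words n" "braid_eq n (v @ u) []"
      using class_inverse[OF u(1)] by blast
    have "braid_rel n `` {v @ u} = braid_rel n `` {[]}"
      using v(2) by (intro equiv_class_eq[OF equiv_braid_rel]) (simp add: braid_rel_def)
    then show ?thesis
      using u v by (intro bexI[of _ "braid_rel n `` {v}"]) (auto simp: class_mult one class_in_carrier)
  qed
qed

lemma artin_gen_carrier: "i \<in> {1..<n} \<Longrightarrow> artin_gen n i \<in> carrier (braid_group n)"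
  unfolding artin_gen_def by (rule class_in_carrier) simp

lemma writhe_hom: "writhe \<in> hom (braid_group n) integer_group"
  by (rule homI) (auto elim!: carrier_braid_groupE simp: class_mult writhe_class word_writhe_append)

lemma writhe_artin_gen: "i \<in> {1..<n} \<Longrightarrow> writhe (artin_gen n i) = 1"
  by (simp add: artin_gen_def writhe_class word_writhe_def)

lemma braid_perm_hom: "braid_perm \<in> hom (braid_group n) (sym_group n)"
  by (rule homI)
    (auto elim!: carrier_braid_groupE
      simp: class_mult braid_perm_class word_perm_append sym_group_def
      word_perm_permutes[simplified])

lemma braid_perm_artin_gen:
  "i \<in> {1..<n} \<Longrightarrow> braid_perm (artin_gen n i) = transpose i (i + 1)"
  by (simp add: artin_gen_def braid_perm_class)

lemma braid_group_generate:
  "carrier (braid_group n) = generate (braid_group n) (artin_gen n ` {1..<n})"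
proof
  interpret group "braid_group n" by (rule group_braid_group)
  let ?H = "generate (braid_group n) (artin_gen n ` {1..<n})"
  show "?H \<subseteq> carrier (braid_group n)"
    by (intro generate_incl) (auto simp: artin_gen_carrier)
  have "braid_rel n `` {u} \<in> ?H" if "u \<in> braid_words n" for u
    using that
  proof (induction u)
    case Nil
    have "\<one>\<^bsub>braid_group n\<^esub> \<in> ?H" by (rule generate.one)
    then show ?case by (simp add: braid_group_def)
  next
    case (Cons a u)
    obtain i b where a: "a = (i, b)" by (cases a)
    have i: "i \<in> {1..<n}" and u: "u \<in> braid_words n" using Cons.prems a by auto
    have "braid_rel n `` {[(i, False)]} \<otimes>\<^bsub>braid_group n\<^esub> artin_gen n i
        = braid_rel n `` {[(i, False), (i, True)]}"
      using i by (simp add: artin_gen_def class_mult)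
    also have "\<dots> = braid_rel n `` {[]}"
      using braid_eq.cancel[OF i, of False]
      by (intro equiv_class_eq[OF equiv_braid_rel]) (simp add: braid_rel_def)
    also have "\<dots> = \<one>\<^bsub>braid_group n\<^esub>" by (simp add: braid_group_def)
    finally have "inv\<^bsub>braid_group n\<^esub> (artin_gen n i) = braid_rel n `` {[(i, False)]}"
      using i by (intro inv_equality) (auto simp: artin_gen_carrier class_in_carrier)
    then have "braid_rel n `` {[a]} \<in> ?H"
      using i a generate.incl[of "artin_gen n i" "artin_gen n ` {1..<n}" "braid_group n"]
        generate.inv[of "artin_gen n i" "artin_gen n ` {1..<n}" "braid_group n"]
      by (cases b) (auto simp: artin_gen_def)
    then have "braid_rel n `` {[a]} \<otimes>\<^bsub>braid_group n\<^esub> braid_rel n `` {u} \<in> ?H"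
      using Cons.IH u by (intro generate.eng) auto
    then show ?case using a i u by (simp add: class_mult)
  qed
  then show "carrier (braid_group n) \<subseteq> ?H"
    by (auto elim!: carrier_braid_groupE)
qed

lemma braid_hom_unique:
  assumes "group G" "f \<in> hom (braid_group n) G" "g \<in> hom (braid_group n) G"
    and "\<And>i. i \<in> {1..<n} \<Longrightarrow> f (artin_gen n i) = g (artin_gen n i)"
    and "\<beta> \<in> carrier (braid_group n)"
  shows "f \<beta> = g \<beta>"
proof -
  interpret F: group_hom "braid_group n" G f
    using assms group_braid_group by (simp add: group_hom_def group_hom_axioms_def)
  interpret H: group_hom "braid_group n" G g
    using assms group_braid_group by (simp add: group_hom_def group_hom_axioms_def)
  have "\<beta> \<in> generate (braid_group n) (artin_gen n ` {1..<n})"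
    using assms(5) braid_group_generate by blast
  then show ?thesis
  proof (induction rule: generate.induct)
    case (eng h1 h2)
    then have "h1 \<in> carrier (braid_group n)" "h2 \<in> carrier (braid_group n)"
      using braid_group_generate by blast+
    with eng show ?case by simp
  qed (auto simp: assms(4) artin_gen_carrier)
qed

end

theory Submission
  imports Defs
begin

text \<open>
  Each letter \<open>\<sigma>\<^sub>i\<^sup>\<plusminus>\<close> of a word contributes \<open>\<plusminus>1\<close> to the writhe and an odd factor to the
  permutation, so the two parities always agree (\<open>evenperm_word_perm\<close>).  This is necessity.

  For sufficiency, adjacent transpositions generate \<open>S\<^sub>n\<close> (\<open>permutes_imp_word_perm\<close>), so some word
  has permutation \<open>\<pi>\<close>.  By necessity its writhe has the parity of \<open>\<pi>\<close>, hence differs from \<open>w\<close> by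
  an even number \<open>2 k\<close>.  The \<open>2 k\<close>-th power of \<open>\<sigma>\<^sub>1\<close> has trivial permutation and
  writhe \<open>2 k\<close> (\<open>pure_word_of_even_writhe\<close>), and multiplying by it corrects the writhe without
  disturbing \<open>\<pi>\<close>.
\<close>

lemma evenperm_word_perm:
  assumes "u \<in> braid_words n"
  shows "evenperm (word_perm u) \<longleftrightarrow> even (word_writhe u)"
  using assms
proof (induction u)
  case Nil
  show ?case by (simp add: word_writhe_def)
next
  case (Cons a u)
  obtain i b where a: "a = (i, b)" by (cases a)
  have u: "u \<in> braid_words n" using Cons.prems a by simp
  have "permutation (word_perm u)"
    using word_perm_permutes[OF u] by (auto simp: permutation_permutes)
  then have "evenperm (word_perm (a # u)) \<longleftrightarrow> \<not> evenperm (word_perm u)"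
    by (simp add: a evenperm_comp permutation_swap_id evenperm_swap)
  moreover have "even (word_writhe (a # u)) \<longleftrightarrow> \<not> even (word_writhe u)"
    by (simp add: a word_writhe_def)
  ultimately show ?case using Cons.IH[OF u] by simp
qed

text \<open>
  Conjugating \<open>(a, b)\<close> by \<open>(b, b + 1)\<close> gives \<open>(a, b + 1)\<close>, so every transposition is
  reached from an adjacent one by moving its larger entry up one step at a time.
\<close>

lemma transpose_eq_word_perm:
  assumes "1 \<le> a" "a < b" "b \<le> n"
  shows "\<exists>u \<in> braid_words n. word_perm u = transpose a b"
  using assms(2,3)
proof (induction b)
  case 0
  then show ?case by simp
next
  case (Suc b)
  show ?case
  proof (cases "a = b")
    case True
    then show ?thesis
      using Suc.prems assms(1) by (intro bexI[of _ "[(b, True)]"]) auto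
  next
    case False
    then obtain u where u: "u \<in> braid_words n" "word_perm u = transpose a b"
      using Suc by auto
    have "transpose b (Suc b) \<circ> transpose a b \<circ> transpose b (Suc b) = transpose a (Suc b)"
      using Suc.prems False by (auto simp: fun_eq_iff transpose_def)
    then have "word_perm ([(b, True)] @ u @ [(b, True)]) = transpose a (Suc b)"
      by (simp add: word_perm_append u comp_assoc)
    moreover have "[(b, True)] @ u @ [(b, True)] \<in> braid_words n"
      using u Suc.prems assms(1) False by auto
    ultimately show ?thesis by blast
  qed
qed

lemma permutes_imp_word_perm:
  assumes "p permutes {1..n}"
  shows "\<exists>u \<in> braid_words n. word_perm u = p"
  using assms finite_atLeastAtMost
proof (induction rule: permutes_induct)
  case id
  show ?case by (intro bexI[of _ "[]"]) auto
next
  case (swap a b p)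
  have "\<exists>v \<in> braid_words n. word_perm v = transpose a b"
  proof (cases a b rule: linorder_cases)
    case less
    then show ?thesis using swap by (intro transpose_eq_word_perm) auto
  next
    case equal
    then show ?thesis by (intro bexI[of _ "[]"]) auto
  next
    case greater
    then show ?thesis
      using swap by (subst transpose_commute, intro transpose_eq_word_perm) auto
  qed
  then obtain u v where "u \<in> braid_words n" "word_perm u = p"
      "v \<in> braid_words n" "word_perm v = transpose a b"
    using swap by blast
  then show ?case by (intro bexI[of _ "v @ u"]) (auto simp: word_perm_append)
qed

text \<open>
  Since \<open>\<sigma>\<^sub>1\<close> and its inverse both map to the involution \<open>(1, 2)\<close>, every even power of either has
  trivial permutation; the choice between the two supplies the sign of \<open>d\<close>.
\<close>

lemma pure_word_of_even_writhe:
  assumes "n \<ge> 2" and "even d"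
  shows "\<exists>v \<in> braid_words n. word_writhe v = d \<and> word_perm v = id"
proof -
  define tw where "tw m b = replicate (2 * m) (1 :: nat, b :: bool)" for m b
  have tw: "tw m b \<in> braid_words n \<and> word_perm (tw m b) = id
      \<and> word_writhe (tw m b) = (if b then 2 * int m else - 2 * int m)" for m b
    using assms(1) by (induction m) (auto simp: tw_def word_writhe_def fun_eq_iff)
  obtain k where k: "d = 2 * k" using assms(2) by blast
  have "word_writhe (tw (nat \<bar>k\<bar>) (k \<ge> 0)) = d" by (simp add: tw k)
  then show ?thesis using tw by blast
qed

theorem theorem2p5:
  fixes n :: nat and w :: int and \<pi> :: "nat \<Rightarrow> nat"
  assumes "n \<ge> 2" and "\<pi> \<in> carrier (sym_group n)"
  shows "(\<exists>\<beta> \<in> carrier (braid_group n). writhe \<beta> = w \<and> braid_perm \<beta> = \<pi>)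
    \<longleftrightarrow> (evenperm \<pi> \<longleftrightarrow> even w)"
proof
  assume "\<exists>\<beta> \<in> carrier (braid_group n). writhe \<beta> = w \<and> braid_perm \<beta> = \<pi>"
  then show "evenperm \<pi> \<longleftrightarrow> even w"
    by (auto elim!: carrier_braid_groupE simp: writhe_class braid_perm_class evenperm_word_perm)
next
  assume parity: "evenperm \<pi> \<longleftrightarrow> even w"
  obtain u where u: "u \<in> braid_words n" "word_perm u = \<pi>"
    using assms(2) permutes_imp_word_perm by (auto simp: sym_group_carrier)
  have "even (w - word_writhe u)"
    using parity evenperm_word_perm[OF u(1)] u(2) by simp
  then obtain v where v: "v \<in> braid_words n" "word_writhe v = w - word_writhe u" "word_perm v = id"
    using pure_word_of_even_writhe[OF assms(1)] by blast
  have "u @ v \<in> braid_words n" using u v by simp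
  then show "\<exists>\<beta> \<in> carrier (braid_group n). writhe \<beta> = w \<and> braid_perm \<beta> = \<pi>"
    using u v
    by (intro bexI[of _ "braid_rel n `` {u @ v}"])
      (simp_all add: writhe_class braid_perm_class word_writhe_append word_perm_append class_in_carrier)
qed

end
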